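(* Let $p,q,p',q'\in\mathbb{N}_{>0}$, let $l\ge1$, and let $f_1,f_2$ be $\mathbb{C}^l$-valued holomorphic functions on a neighborhood of the origin in $\mathbb{C}\times\mathbb{C}\times\mathbb{C}^l$. Suppose that the Pfaffian system $$x_2^{q}x_1^{p+1}\frac{\partial \mathbf{y}}{\partial x_1}=f_1(x_1,x_2,\mathbf{y}),\qquad x_1^{p'}x_2^{q'+1}\frac{\partial \mathbf{y}}{\partial x_2}=f_2(x_1,x_2,\mathbf{y})$$ is completely integrable. Write $A(x_1,x_2)=\frac{\partial f_1}{\partial\mathbf{y}}(x_1,x_2,\mathbf{0})$ and $B(x_1,x_2)=\frac{\partial f_2}{\partial\mathbf{y}}(x_1,x_2,\mathbf{0})$. Then: (1) If $p'<p$ or $q'<q$ then $A(0,0)$ is nilpotent. (2) If $p<p'$ or $q<q'$ then $B(0,0)$ is nilpotent. (3) If $p=p'$ and $q=q'$, then for every eigenvalue $\mu$ of $B(0,0)$ there is an eigenvalue $\lambda$ of $A(0,0)$ such that $q\lambda=p\mu$. The number $\lambda$ is an eigenvalue of $A(0,0)$ when restricted to its invariant subspace $\{v\in\mathbb{C}^l : (B(0,0)-\mu I)^kv=0\text{ for some }k\in\mathbb{N}\}$.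
   Context: $\mathbb{N}_{>0}$ denotes the positive integers. The system is called completely integrable if $f_1(x_1,x_2,\mathbf{0})=f_2(x_1,x_2,\mathbf{0})=\mathbf{0}$ and the following identity holds on the domain of definition of $f_1,f_2$ (all functions evaluated at $(x_1,x_2,\mathbf{y})$): $$-qx_1^{p'}x_2^{q'}f_1+x_1^{p'}x_2^{q'+1}\frac{\partial f_1}{\partial x_2}+\frac{\partial f_1}{\partial \mathbf{y}}f_2=-p'x_1^{p}x_2^{q}f_2+x_1^{p+1}x_2^{q}\frac{\partial f_2}{\partial x_1}+\frac{\partial f_2}{\partial \mathbf{y}}f_1 .$$ Here $\frac{\partial f_i}{\partial\mathbf{y}}$ is the $l\times l$ Jacobian matrix with respect to $\mathbf{y}$, and $I$ is the identity matrix. *)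

theory Defs
  imports "HOL-Analysis.Analysis"
begin

text \<open>
  Holomorphy in several variables: at every point of the set, \<open>f\<close> is Frechet
  differentiable with a derivative that commutes with complex scalars.  This is the usual
  notion when \<open>S\<close> is open, the only case in which it is used.
\<close>

definition complex_linear ::
    "(complex \<times> complex \<times> (complex ^ 'm) \<Rightarrow> complex ^ 'n) \<Rightarrow> bool" where
  "complex_linear D \<longleftrightarrow> linear D \<and> (\<forall>c a b v. D (c * a, c * b, c *s v) = c *s D (a, b, v))"

definition holomorphic_on_multi ::
    "(complex \<times> complex \<times> (complex ^ 'm) \<Rightarrow> complex ^ 'n) \<Rightarrow>
     (complex \<times> complex \<times> (complex ^ 'm)) set \<Rightarrow> bool" where
  "holomorphic_on_multi f S \<longleftrightarrow> (\<forall>z\<in>S. \<exists>D. complex_linear D \<and> (f has_derivative D) (at z))"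

definition partial_x1 ::
    "(complex \<times> complex \<times> (complex ^ 'm) \<Rightarrow> complex ^ 'n) \<Rightarrow>
     complex \<times> complex \<times> (complex ^ 'm) \<Rightarrow> complex ^ 'n" where
  "partial_x1 f = (\<lambda>(x1, x2, y). \<chi> i. deriv (\<lambda>t. f (t, x2, y) $ i) x1)"

definition partial_x2 ::
    "(complex \<times> complex \<times> (complex ^ 'm) \<Rightarrow> complex ^ 'n) \<Rightarrow>
     complex \<times> complex \<times> (complex ^ 'm) \<Rightarrow> complex ^ 'n" where
  "partial_x2 f = (\<lambda>(x1, x2, y). \<chi> i. deriv (\<lambda>t. f (x1, t, y) $ i) x2)"

text \<open>Jacobian matrix in \<open>y\<close>: row \<open>i\<close>, column \<open>j\<close> holds the complex partial derivative
  of the \<open>i\<close>-th component of \<open>f\<close> with respect to the \<open>j\<close>-th component of \<open>y\<close>.\<close>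

definition jacobian_y ::
    "(complex \<times> complex \<times> (complex ^ 'm) \<Rightarrow> complex ^ 'n) \<Rightarrow>
     complex \<times> complex \<times> (complex ^ 'm) \<Rightarrow> complex ^ 'm ^ 'n" where
  "jacobian_y f = (\<lambda>(x1, x2, y).
     \<chi> i j. deriv (\<lambda>t. f (x1, x2, \<chi> k. if k = j then t else y $ k) $ i) (y $ j))"

text \<open>Complete integrability, on the domain \<open>U\<close>, of the Pfaffian system
  \<open>x2^q x1^(p+1) dy/dx1 = f1(x1,x2,y)\<close>, \<open>x1^p' x2^(q'+1) dy/dx2 = f2(x1,x2,y)\<close>.\<close>

definition completely_integrable ::
    "nat \<Rightarrow> nat \<Rightarrow> nat \<Rightarrow> nat \<Rightarrow>
     (complex \<times> complex \<times> (complex ^ 'l) \<Rightarrow> complex ^ 'l) \<Rightarrow>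
     (complex \<times> complex \<times> (complex ^ 'l) \<Rightarrow> complex ^ 'l) \<Rightarrow>
     (complex \<times> complex \<times> (complex ^ 'l)) set \<Rightarrow> bool" where
  "completely_integrable p q p' q' f1 f2 U \<longleftrightarrow>
     (\<forall>x1 x2. (x1, x2, 0) \<in> U \<longrightarrow> f1 (x1, x2, 0) = 0 \<and> f2 (x1, x2, 0) = 0) \<and>
     (\<forall>x1 x2 y. (x1, x2, y) \<in> U \<longrightarrow>
        (- of_nat q * x1 ^ p' * x2 ^ q') *s f1 (x1, x2, y)
          + (x1 ^ p' * x2 ^ (q' + 1)) *s partial_x2 f1 (x1, x2, y)
          + jacobian_y f1 (x1, x2, y) *v f2 (x1, x2, y)
        = (- of_nat p' * x1 ^ p * x2 ^ q) *s f2 (x1, x2, y)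
          + (x1 ^ (p + 1) * x2 ^ q) *s partial_x1 f2 (x1, x2, y)
          + jacobian_y f2 (x1, x2, y) *v f1 (x1, x2, y))"

text \<open>The type of square matrices is not a monoid under \<open>**\<close> (its \<open>*\<close> is componentwise),
  so powers of matrices are iterated products.\<close>

definition matrix_power :: "'a::semiring_1 ^ 'n ^ 'n \<Rightarrow> nat \<Rightarrow> 'a ^ 'n ^ 'n" where
  "matrix_power M k = (((**) M) ^^ k) (mat 1)"

definition nilpotent_matrix :: "'a::semiring_1 ^ 'n ^ 'n \<Rightarrow> bool" where
  "nilpotent_matrix M \<longleftrightarrow> (\<exists>k. matrix_power M k = 0)"

definition eigenvalue_of :: "'a::field ^ 'n ^ 'n \<Rightarrow> 'a \<Rightarrow> bool" where
  "eigenvalue_of M c \<longleftrightarrow> (\<exists>v. v \<noteq> 0 \<and> M *v v = c *s v)"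

definition invariant_subspace :: "'a::field ^ 'n ^ 'n \<Rightarrow> ('a ^ 'n) set \<Rightarrow> bool" where
  "invariant_subspace M W \<longleftrightarrow> vec.subspace W \<and> (\<forall>v\<in>W. M *v v \<in> W)"

definition eigenvalue_of_restriction ::
    "'a::field ^ 'n ^ 'n \<Rightarrow> ('a ^ 'n) set \<Rightarrow> 'a \<Rightarrow> bool" where
  "eigenvalue_of_restriction M W c \<longleftrightarrow> (\<exists>v\<in>W. v \<noteq> 0 \<and> M *v v = c *s v)"

definition generalized_eigenspace :: "'a::field ^ 'n ^ 'n \<Rightarrow> 'a \<Rightarrow> ('a ^ 'n) set" where
  "generalized_eigenspace M c = {v. \<exists>k. matrix_power (M - mat c) k *v v = 0}"

end

theory Submission
  imports Defs "HOL-Complex_Analysis.Cauchy_Integral_Formula"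
begin

text \<open>
  Differentiating the integrability condition in \<open>y\<close> at \<open>y = 0\<close> gives the identity
  \<open>AB - BA = x1^p' x2^q' (q A - x2 \<partial>A/\<partial>x2) - x1^p x2^q (p' B - x1 \<partial>B/\<partial>x1)\<close>.
  The trace of \<open>X^k (AB - BA)\<close> vanishes for \<open>X = A\<close>, for \<open>X = B\<close> and for every linear
  combination of the two.  For \<open>X = A\<close>, if \<open>p' < p\<close> or \<open>q' < q\<close>, cancelling powers of \<open>x1\<close> and
  \<open>x2\<close> and passing to the limit at the origin gives \<open>tr A(0,0)^(k+1) = 0\<close> for all \<open>k\<close>, so
  \<open>A(0,0)\<close> is nilpotent; part (2) is symmetric.  If \<open>p = p'\<close> and \<open>q = q'\<close>, taking
  \<open>X = q A - p B\<close> shows in the same way that \<open>q A(0,0) - p B(0,0)\<close> is nilpotent.  It commutes with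
  \<open>B(0,0)\<close>, hence kills some eigenvector of \<open>B(0,0)\<close> for \<open>\<mu>\<close>, and on that vector
  \<open>A(0,0)\<close> acts as \<open>p \<mu> / q\<close>.
\<close>

subsection \<open>Matrices whose powers have trace zero\<close>

lemma matrix_power_simps [simp]:
  "matrix_power M 0 = mat 1" "matrix_power M (Suc k) = M ** matrix_power M k"
  by (simp_all add: matrix_power_def)

lemma matrix_power_add: "matrix_power M (j + k) = matrix_power M j ** matrix_power M k"
  by (induction j) (simp_all add: matrix_mul_assoc)

lemma linear_matrix_mult_left: "linear (\<lambda>X. M ** (X :: complex^'n^'m))"
  by (rule linearI)
    (simp_all add: matrix_matrix_mult_def vec_eq_iff algebra_simps sum.distrib scaleR_right.sum)

lemma linear_matrix_mult_right: "linear (\<lambda>X. (X :: complex^'n^'m) ** M)"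
  by (rule linearI)
    (simp_all add: matrix_matrix_mult_def vec_eq_iff algebra_simps sum.distrib scaleR_right.sum)

lemma linear_trace: "linear (trace :: complex^'n^'n \<Rightarrow> complex)"
  by (rule linearI) (simp_all add: trace_def sum.distrib scaleR_right.sum)

text \<open>In the Leibniz expansion the product rule removes one factor of each term and evaluates
  the others at \<open>t = 0\<close>, leaving entries of the identity matrix. A nontrivial
  permutation moves at least two points, so a zero factor remains; only the identity permutation
  contributes.\<close>

lemma has_field_derivative_det_one_plus:
  fixes M :: "complex^'n^'n"
  shows "((\<lambda>t. det (mat 1 + (\<chi> i j. t * M $ i $ j))) has_field_derivative trace M) (at 0)"
proof -
  let ?c = "\<lambda>s i t. (if i = s i then 1 else 0) + t * M $ i $ s i"
  have eq: "det (mat 1 + (\<chi> i j. t * M $ i $ j)) =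
      (\<Sum>s | s permutes UNIV. of_int (sign s) * (\<Prod>i\<in>UNIV. ?c s i t))" for t
    by (simp add: det_def mat_def)
  have prod0: "(\<Sum>i\<in>UNIV. M $ i $ s i * (\<Prod>j\<in>UNIV - {i}. if j = s j then 1 else 0)) =
      (if s = id then trace M else 0)" if s: "s permutes UNIV" for s :: "'n \<Rightarrow> 'n"
  proof (cases "s = id")
    case True
    then show ?thesis by (simp add: trace_def)
  next
    case False
    have "(\<Prod>j\<in>UNIV - {i}. if j = s j then (1::complex) else 0) = 0" for i
    proof -
      obtain k where k: "s k \<noteq> k" using False by (auto simp: fun_eq_iff)
      then have k2: "s (s k) \<noteq> s k" using permutes_inj[OF s] by (auto dest: injD)
      \<comment> \<open>Both \<open>k\<close> and \<open>s k\<close> are moved by \<open>s\<close>,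
        and at most one of them is the removed index \<open>i\<close>.\<close>
      have "\<exists>j\<in>UNIV - {i}. j \<noteq> s j"
        using k k2 by (cases "k = i") (auto intro: bexI[of _ k] bexI[of _ "s k"])
      then show ?thesis by (intro prod_zero) auto
    qed
    then have "(\<Sum>i\<in>UNIV. M $ i $ s i * (\<Prod>j\<in>UNIV - {i}. if j = s j then 1 else 0)) = 0"
      by (simp only: mult_zero_right sum.neutral_const)
    then show ?thesis using False by simp
  qed
  have d: "((\<lambda>t. \<Prod>i\<in>UNIV. ?c s i t) has_field_derivative
      (\<Sum>i\<in>UNIV. M $ i $ s i * (\<Prod>j\<in>UNIV - {i}. ?c s j 0))) (at 0)" for s
    by (rule has_field_derivative_prod) (auto intro!: derivative_eq_intros)
  have "((\<lambda>t. \<Sum>s | s permutes UNIV. of_int (sign s) * (\<Prod>i\<in>UNIV. ?c s i t)) has_field_derivative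
      (\<Sum>s | s permutes (UNIV::'n set). of_int (sign s) *
         (\<Sum>i\<in>UNIV. M $ i $ s i * (\<Prod>j\<in>UNIV - {i}. ?c s j 0)))) (at 0)"
    by (intro DERIV_sum DERIV_cmult d)
  also have "(\<Sum>s | s permutes (UNIV::'n set). of_int (sign s) *
         (\<Sum>i\<in>UNIV. M $ i $ s i * (\<Prod>j\<in>UNIV - {i}. ?c s j 0))) =
      (\<Sum>s | s permutes (UNIV::'n set). if s = id then trace M else 0)"
    by (rule sum.cong) (auto simp: prod0)
  also have "\<dots> = trace M"
    by (simp add: finite_permutations permutes_id)
  finally show ?thesis unfolding eq .
qed

text \<open>
  The map \<open>u \<mapsto> det (1 + (u - 1) E)\<close> is multiplicative when \<open>E\<close> is idempotent, and its derivative at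
  \<open>1\<close> is the trace of \<open>E\<close>.  If this is zero, the map is constant and \<open>1 - E\<close> is invertible.
\<close>

lemma idempotent_trace_zero:
  fixes E :: "complex^'n^'n"
  assumes E: "E ** E = E" and tr: "trace E = 0"
  shows "E = 0"
proof -
  define S where "S = (\<lambda>t. (\<chi> i j. t * E $ i $ j) :: complex^'n^'n)"
  define \<phi> where "\<phi> = (\<lambda>t. det (mat 1 + S t))"
  have SS: "S s ** S t = S (s * t)" for s t
  proof -
    have "(S s ** S t) $ i $ j = s * t * (E ** E) $ i $ j" for i j
      by (simp add: S_def matrix_matrix_mult_def sum_distrib_left algebra_simps)
    then show ?thesis by (simp add: vec_eq_iff E) (simp add: S_def)
  qed
  have S_add: "S (s + t) = S s + S t" for s t
    by (simp add: S_def vec_eq_iff algebra_simps)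
  \<comment> \<open>With \<open>u = 1 + t\<close> this is multiplicativity in \<open>u\<close>,
    because \<open>1 + (s + t + s * t) = (1 + s) * (1 + t)\<close>.\<close>
  have \<phi>_mult: "\<phi> (s + t + s * t) = \<phi> s * \<phi> t" for s t
  proof -
    have "mat 1 + S (s + t + s * t) = (mat 1 + S s) ** (mat 1 + S t)"
      by (simp add: S_add SS[symmetric] matrix_add_ldistrib linear_add[OF linear_matrix_mult_right] algebra_simps)
    then show ?thesis by (simp add: \<phi>_def det_mul)
  qed
  have d0: "(\<phi> has_field_derivative 0) (at 0)"
    using has_field_derivative_det_one_plus[of E] tr unfolding \<phi>_def S_def by simp
  \<comment> \<open>Multiplicativity writes \<open>\<phi> u\<close> as \<open>\<phi> s\<close> times
    the value of \<open>\<phi>\<close> at \<open>(u - s) / (1 + s)\<close>. This argument is 0 at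
    \<open>u = s\<close>, so the zero derivative at 0 is carried to \<open>s\<close>.\<close>
  have deriv0: "(\<phi> has_field_derivative 0) (at s)" if s: "1 + s \<noteq> 0" for s
  proof -
    have lim: "((\<lambda>u. (u - s) / (1 + s)) has_field_derivative (1 / (1 + s))) (at s)"
      by (rule DERIV_cdivide) (auto intro!: derivative_eq_intros)
    have "((\<lambda>u. \<phi> ((u - s) / (1 + s))) has_field_derivative 0 * (1 / (1 + s))) (at s)"
      by (rule DERIV_chain2[OF _ lim]) (use d0 in simp)
    then have "((\<lambda>u. \<phi> s * \<phi> ((u - s) / (1 + s))) has_field_derivative \<phi> s * (0 * (1 / (1 + s)))) (at s)"
      by (rule DERIV_cmult)
    moreover have "\<phi> s * \<phi> ((u - s) / (1 + s)) = \<phi> u" for u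
    proof -
      have "s + (u - s) / (1 + s) + s * ((u - s) / (1 + s)) = u"
        using s by (simp add: divide_simps, simp add: algebra_simps)
      then show ?thesis using \<phi>_mult[of s "(u - s) / (1 + s)"] by simp
    qed
    ultimately show ?thesis by simp
  qed
  have \<phi>0: "\<phi> 0 = 1" by (simp add: \<phi>_def S_def zero_vec_def[symmetric])
  have cont: "continuous_on UNIV \<phi>"
    unfolding \<phi>_def S_def det_def by (simp add: mat_def) (intro continuous_intros)
  \<comment> \<open>On the real segment from -1 to 0 the derivative vanishes except at the endpoint
    -1, where \<open>1 + s = 0\<close>; there continuity suffices.\<close>
  have "\<phi> (of_real 0) = \<phi> (of_real (-1))"
  proof (rule has_derivative_zero_unique_strong_interval[where k = "{-1}" and a = "-1" and b = 0])
    show "finite {-1::real}" by simp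
    show "continuous_on {-1..0} (\<lambda>x. \<phi> (of_real x))"
      by (rule continuous_on_compose2[OF cont]) (auto intro: continuous_intros)
    fix y :: real assume "y \<in> {-1..0} - {-1}"
    then have "1 + complex_of_real y \<noteq> 0"
      by (metis Diff_iff add_eq_0_iff of_real_1 of_real_eq_iff of_real_minus singleton_iff
          add.commute)
    from deriv0[OF this] have "((\<lambda>x. \<phi> (of_real x)) has_vector_derivative 0) (at y)"
      using has_vector_derivative_real_field by fastforce
    then show "((\<lambda>x. \<phi> (of_real x)) has_derivative (\<lambda>h. 0)) (at y within {-1..0})"
      by (auto simp: has_vector_derivative_def intro: has_derivative_at_withinI)
  qed auto
  then have "\<phi> (-1) = 1" using \<phi>0 by simp
  moreover have "mat 1 + S (-1) = mat 1 - E" by (simp add: S_def vec_eq_iff)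
  ultimately have "det (mat 1 - E) = 1" by (simp add: \<phi>_def)
  then have "invertible (mat 1 - E)" by (simp add: invertible_det_nz)
  then obtain X where X: "X ** (mat 1 - E) = mat 1" by (auto simp: invertible_def)
  have "(mat 1 - E) ** E = 0"
    using linear_diff[OF linear_matrix_mult_right[of E], of "mat 1" E] E by simp
  then have "X ** (mat 1 - E) ** E = 0"
    using linear_0[OF linear_matrix_mult_left[of X]] by (simp add: matrix_mul_assoc[symmetric])
  then show ?thesis using X by simp
qed

text \<open>
  The spans \<open>P r\<close> of the powers \<open>M^k\<close> with \<open>k \<ge> r\<close> stabilise.  For such an \<open>r\<close> there is
  \<open>H \<in> P r\<close> with \<open>M^r H = M^r\<close>; it is an idempotent without constant term in \<open>M\<close>, so its trace
  is zero.
\<close>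

lemma nilpotent_if_traces_zero:
  fixes M :: "complex^'n^'n"
  assumes tr: "\<And>k. trace (matrix_power M (Suc k)) = 0"
  shows "nilpotent_matrix M"
proof -
  define P where "P = (\<lambda>r. span {matrix_power M k |k. k \<ge> r})"
  \<comment> \<open>The real spans \<open>P r\<close> decrease with \<open>r\<close>, so one of
    least dimension equals all later ones. Taking \<open>r \<ge> 1\<close> keeps the zeroth power,
    whose trace is not controlled, out of the generators.\<close>
  obtain r where r: "r \<ge> 1" "\<And>s. s \<ge> 1 \<Longrightarrow> dim (P r) \<le> dim (P s)"
    using ex_has_least_nat[of "\<lambda>r. r \<ge> (1::nat)" 1 "\<lambda>r. dim (P r)"] by auto
  have "P (2 * r) = P r"
  proof (rule subspace_dim_equal)
    show "P (2 * r) \<subseteq> P r" unfolding P_def by (rule span_mono) auto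
    show "dim (P r) \<le> dim (P (2 * r))" using r by simp
  qed (simp_all add: P_def)
  moreover have "matrix_power M r \<in> P r" unfolding P_def by (rule span_base) auto
  \<comment> \<open>Multiplication by the \<open>r\<close>-th power shifts exponents from
    \<open>k \<ge> r\<close> to \<open>k \<ge> 2 * r\<close>. As that power lies in
    \<open>P r = P (2 * r)\<close>, it is the image of some \<open>H\<close> in
    \<open>P r\<close>.\<close>
  moreover have "P (2 * r) = (\<lambda>X. matrix_power M r ** X) ` P r"
  proof -
    have "{matrix_power M k |k. k \<ge> 2 * r} = (\<lambda>X. matrix_power M r ** X) ` {matrix_power M k |k. k \<ge> r}"
    proof (intro equalityI subsetI)
      fix X assume "X \<in> {matrix_power M k |k. k \<ge> 2 * r}"
      then obtain k where "X = matrix_power M k" "k \<ge> 2 * r" by auto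
      then have "X = matrix_power M r ** matrix_power M (k - r)" "k - r \<ge> r"
        by (auto simp: matrix_power_add[symmetric])
      then show "X \<in> (\<lambda>X. matrix_power M r ** X) ` {matrix_power M k |k. k \<ge> r}" by blast
    next
      fix X assume "X \<in> (\<lambda>X. matrix_power M r ** X) ` {matrix_power M k |k. k \<ge> r}"
      then obtain k where "X = matrix_power M (r + k)" "k \<ge> r" by (auto simp: matrix_power_add)
      then show "X \<in> {matrix_power M k |k. k \<ge> 2 * r}" by (auto intro: exI[of _ "r + k"])
    qed
    then show ?thesis
      unfolding P_def by (simp add: linear_span_image[OF linear_matrix_mult_left])
  qed
  ultimately obtain H where H: "H \<in> P r" "matrix_power M r = matrix_power M r ** H" by auto
  \<comment> \<open>Each generator has the \<open>r\<close>-th power of \<open>M\<close> as its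
    right factor, which \<open>H\<close> fixes. Applied to \<open>H\<close> itself this gives
    idempotence.\<close>
  have unit: "X ** H = X" if "X \<in> P r" for X
    using that unfolding P_def
  proof (induction rule: span_induct)
    case base
    show ?case
      by (rule subspaceI) (simp_all add: linear_0[OF linear_matrix_mult_right]
        linear_add[OF linear_matrix_mult_right] linear_cmul[OF linear_matrix_mult_right])
  next
    case (step X)
    then obtain k where "k \<ge> r" "X = matrix_power M k" by auto
    then have "X = matrix_power M (k - r) ** matrix_power M r"
      by (simp add: matrix_power_add[symmetric])
    then show ?case using H(2) by (simp add: matrix_mul_assoc[symmetric])
  qed
  have "trace X = 0" if "X \<in> P r" for X
    using that unfolding P_def
  proof (induction rule: span_induct)
    case base
    show ?case
      by (rule subspaceI) (simp_all add: linear_0[OF linear_trace]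
        linear_add[OF linear_trace] linear_cmul[OF linear_trace])
  next
    case (step X)
    then obtain k where "X = matrix_power M k" "k \<ge> r" by auto
    then have "X = matrix_power M (Suc (k - 1))" using r(1) by (metis Suc_diff_1 One_nat_def Suc_le_lessD le_trans)
    then show ?case using tr by blast
  qed
  then have "H = 0" using H(1) unit[OF H(1)] idempotent_trace_zero by blast
  then have "matrix_power M r = 0"
    using H(2) linear_0[OF linear_matrix_mult_left] by metis
  then show ?thesis unfolding nilpotent_matrix_def by blast
qed

subsection \<open>Directional derivatives of holomorphic functions\<close>

text \<open>By uniform continuity on a compact ball, the functions
  \<open>t \<mapsto> g (z + c t)\<close> converge uniformly on a disc as \<open>z\<close> tends to
  \<open>z0\<close>. They are holomorphic there, so by Weierstrass their derivatives at 0 converge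
  as well.\<close>

lemma directional_deriv_continuous_on:
  fixes g :: "'a::euclidean_space \<Rightarrow> complex" and c :: "complex \<Rightarrow> 'a"
  assumes U: "open U" and g: "continuous_on U g"
    and c: "continuous_on UNIV c" and c0: "c 0 = 0"
    and holo: "\<And>z t. z + c t \<in> U \<Longrightarrow> (\<lambda>t. g (z + c t)) field_differentiable (at t)"
  shows "continuous_on U (\<lambda>z. deriv (\<lambda>t. g (z + c t)) 0)"
proof (rule continuous_at_imp_continuous_on, rule ballI)
  fix z0 assume z0: "z0 \<in> U"
  obtain e where e: "e > 0" "cball z0 e \<subseteq> U"
    using U z0 open_contains_cball by blast
  have "isCont c 0" using c continuous_on_eq_continuous_at by blast
  then obtain r0 where r0: "r0 > 0" "\<And>t. dist t 0 < r0 \<Longrightarrow> dist (c t) (c 0) < e / 2"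
    using e by (metis continuous_at_eps_delta dist_norm half_gt_zero)
  define r where "r = r0 / 2"
  have r: "r > 0" "\<And>t. t \<in> cball 0 r \<Longrightarrow> norm (c t) < e / 2"
    using r0 c0 unfolding r_def by (auto simp: dist_norm)
  have inU: "z + c t \<in> cball z0 e" if "z \<in> ball z0 (e/2)" "t \<in> cball 0 r" for z t
  proof -
    have "dist z0 (z + c t) \<le> dist z0 z + norm (c t)"
      by (metis dist_add_cancel dist_triangle add.right_neutral dist_0_norm)
    then show ?thesis using r(2)[OF that(2)] that(1) by auto
  qed
  have near: "\<forall>\<^sub>F z in at z0. z \<in> ball z0 (e/2)"
    by (rule eventually_at_in_open') (use e in auto)
  have uc: "uniformly_continuous_on (cball z0 e) g"
    by (rule compact_uniformly_continuous) (use e g continuous_on_subset in auto)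
  have ul: "uniform_limit (cball 0 r) (\<lambda>z t. g (z + c t)) (\<lambda>t. g (z0 + c t)) (at z0)"
    unfolding uniform_limit_iff
  proof (intro allI impI)
    fix \<epsilon> :: real assume "\<epsilon> > 0"
    then obtain d where d: "d > 0" "\<And>x y. x \<in> cball z0 e \<Longrightarrow> y \<in> cball z0 e \<Longrightarrow> dist y x < d \<Longrightarrow> dist (g y) (g x) < \<epsilon>"
      using uc unfolding uniformly_continuous_on_def by metis
    have "\<forall>\<^sub>F z in at z0. z \<in> ball z0 d"
      by (rule eventually_at_in_open') (use d in auto)
    with near show "\<forall>\<^sub>F z in at z0. \<forall>t\<in>cball 0 r. dist (g (z + c t)) (g (z0 + c t)) < \<epsilon>"
    proof eventually_elim
      case (elim z)
      show ?case
      proof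
        fix t assume t: "t \<in> cball (0::complex) r"
        show "dist (g (z + c t)) (g (z0 + c t)) < \<epsilon>"
          by (rule d(2)) (use inU[OF _ t] elim e in \<open>auto simp: dist_commute\<close>)
      qed
    qed
  qed
  have der: "((\<lambda>t. g (z + c t)) has_field_derivative deriv (\<lambda>t. g (z + c t)) t) (at t)"
    if "z + c t \<in> U" for z t
    using holo[OF that] field_differentiable_derivI by blast
  have "\<forall>\<^sub>F z in at z0. continuous_on (cball 0 r) (\<lambda>t. g (z + c t)) \<and>
      (\<forall>w\<in>ball 0 r. ((\<lambda>t. g (z + c t)) has_field_derivative deriv (\<lambda>t. g (z + c t)) w) (at w))"
    using near
  proof eventually_elim
    case (elim z)
    show ?case
    proof (intro conjI ballI)
      show "continuous_on (cball 0 r) (\<lambda>t. g (z + c t))"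
        by (intro continuous_at_imp_continuous_on ballI field_differentiable_imp_continuous_at holo)
          (use inU elim e in blast)
      fix w :: complex assume "w \<in> ball 0 r"
      then show "((\<lambda>t. g (z + c t)) has_field_derivative deriv (\<lambda>t. g (z + c t)) w) (at w)"
        by (intro der) (use inU[of z w] elim e in auto)
    qed
  qed
  from has_complex_derivative_uniform_limit[OF this ul trivial_limit_at r(1)]
  obtain g' where g': "\<And>w. w \<in> ball 0 r \<Longrightarrow> ((\<lambda>t. g (z0 + c t)) has_field_derivative g' w) (at w)
      \<and> ((\<lambda>z. deriv (\<lambda>t. g (z + c t)) w) \<longlongrightarrow> g' w) (at z0)"
    by metis
  have "g' 0 = deriv (\<lambda>t. g (z0 + c t)) 0"
    using g'[of 0] r(1) DERIV_imp_deriv by (metis centre_in_ball)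
  then show "isCont (\<lambda>z. deriv (\<lambda>t. g (z + c t)) 0) z0"
    using g'[of 0] r(1) unfolding isCont_def by simp
qed

text \<open>
  Where \<open>g\<close> vanishes along \<open>c\<close>, the quotients \<open>g(z0 + d s + c t) / s\<close> converge to the derivative
  \<open>a\<close> of \<open>g\<close> along \<open>d\<close> uniformly in \<open>t\<close>, so their \<open>t\<close>-derivatives converge too.  This replaces
  the symmetry of the second derivatives.
\<close>

lemma mixed_directional_deriv_limit:
  fixes g :: "'a::euclidean_space \<Rightarrow> complex" and c d :: "complex \<Rightarrow> 'a"
  assumes U: "open U" and g: "continuous_on U g" and z0: "z0 \<in> U"
    and c: "continuous_on UNIV c" and c0: "c 0 = 0"
    and d: "continuous_on UNIV d" and d_add: "\<And>s t. d (s + t) = d s + d t"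
    and holo_c: "\<And>z t. z + c t \<in> U \<Longrightarrow> (\<lambda>t. g (z + c t)) field_differentiable (at t)"
    and holo_d: "\<And>z s. z + d s \<in> U \<Longrightarrow> (\<lambda>s. g (z + d s)) field_differentiable (at s)"
    and vanish: "\<And>t. z0 + c t \<in> U \<Longrightarrow> g (z0 + c t) = 0"
  defines "a \<equiv> \<lambda>z. deriv (\<lambda>s. g (z + d s)) 0"
  shows "((\<lambda>s. deriv (\<lambda>t. g (z0 + d s + c t)) 0 / s) \<longlongrightarrow> deriv (\<lambda>t. a (z0 + c t)) 0) (at 0)"
    and "(\<lambda>t. a (z0 + c t)) field_differentiable (at 0)"
proof -
  have d0: "d 0 = 0" using d_add[of 0 0] by simp
  have a: "continuous_on U a"
    unfolding a_def by (rule directional_deriv_continuous_on[OF U g d d0 holo_d])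
  obtain e where e: "e > 0" "cball z0 e \<subseteq> U"
    using U z0 open_contains_cball by blast
  have near0: "\<exists>r>0. \<forall>t. norm t < r \<longrightarrow> norm (b t) < \<epsilon>"
    if "continuous_on UNIV b" "b 0 = 0" "\<epsilon> > 0" for b :: "complex \<Rightarrow> 'a" and \<epsilon> :: real
  proof -
    have "isCont b 0" using that(1) continuous_on_eq_continuous_at by blast
    then show ?thesis using that(2,3) unfolding continuous_at_eps_delta by (metis dist_0_norm dist_commute)
  qed
  obtain r1 where r1: "r1 > 0" "\<And>t. norm t < r1 \<Longrightarrow> norm (c t) < e / 2"
    using near0[OF c c0, of "e/2"] e by auto
  obtain r2 where r2: "r2 > 0" "\<And>t. norm t < r2 \<Longrightarrow> norm (d t) < e / 2"
    using near0[OF d d0, of "e/2"] e by auto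
  define r where "r = r1 / 2"
  have r: "r > 0" "r < r1" using r1 unfolding r_def by auto
  have inU: "z0 + c t + d s \<in> cball z0 e" if "norm t \<le> r" "norm s < r2" for s t
  proof -
    have "dist z0 (z0 + c t + d s) = norm (c t + d s)"
      by (metis add.assoc add_diff_cancel_left' dist_commute dist_norm)
    also have "\<dots> \<le> norm (c t) + norm (d s)" by (rule norm_triangle_ineq)
    finally show ?thesis using r1(2)[of t] r2(2)[OF that(2)] that(1) r by auto
  qed
  have near: "\<forall>\<^sub>F s in at 0. s \<in> ball 0 m - {0}" if "m > 0" for m :: real
    by (rule eventually_at_in_open) (use that in auto)
  \<comment> \<open>\<open>a\<close> only records derivatives at parameter 0; additivity of
    \<open>d\<close> moves them to any \<open>s\<close>.\<close>
  have deriv_d: "((\<lambda>s. g (z + d s)) has_field_derivative a (z + d s)) (at s)" if "z + d s \<in> U" for z s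
  proof -
    have "((\<lambda>u. g (z + d s + d u)) has_field_derivative a (z + d s)) (at 0)"
      unfolding a_def by (rule field_differentiable_derivI, rule holo_d) (use that d0 in simp)
    then have "((\<lambda>u. g (z + d (u + s))) has_field_derivative a (z + d s)) (at 0)"
      by (simp add: d_add algebra_simps)
    then show ?thesis
      using DERIV_shift[of "\<lambda>s. g (z + d s)" "a (z + d s)" 0 s] by simp
  qed
  have uc: "uniformly_continuous_on (cball z0 e) a"
    by (rule compact_uniformly_continuous) (use e a continuous_on_subset in auto)
  have ul: "uniform_limit (cball 0 r) (\<lambda>s t. g (z0 + d s + c t) / s) (\<lambda>t. a (z0 + c t)) (at 0)"
    unfolding uniform_limit_iff
  proof (intro allI impI)
    fix \<epsilon> :: real assume \<epsilon>: "\<epsilon> > 0"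
    then obtain \<delta> where \<delta>: "\<delta> > 0" "\<And>x y. x \<in> cball z0 e \<Longrightarrow> y \<in> cball z0 e \<Longrightarrow> dist y x < \<delta> \<Longrightarrow> dist (a y) (a x) < \<epsilon> / 2"
      using uc unfolding uniformly_continuous_on_def by (metis half_gt_zero)
    obtain r3 where r3: "r3 > 0" "\<And>t. norm t < r3 \<Longrightarrow> norm (d t) < \<delta>"
      using near0[OF d d0 \<delta>(1)] by auto
    define m where "m = min r2 r3"
    have m: "m > 0" "m \<le> r2" "m \<le> r3" using r2 r3 unfolding m_def by auto
    show "\<forall>\<^sub>F s in at 0. \<forall>t\<in>cball 0 r. dist (g (z0 + d s + c t) / s) (a (z0 + c t)) < \<epsilon>"
      using near[OF m(1)]
    proof eventually_elim
      case (elim s)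
      show ?case
      proof
        fix t assume t: "t \<in> cball (0::complex) r"
        define z where "z = z0 + c t"
        \<comment> \<open>The error of the linear approximation along \<open>d\<close>. Its
          derivative \<open>a (z + d u) - a z\<close> is below \<open>\<epsilon> / 2\<close>
          uniformly in \<open>t\<close>, and it vanishes at 0, so the mean value inequality bounds
          it by \<open>\<epsilon> / 2 * norm s\<close>.\<close>
        define \<phi> where "\<phi> = (\<lambda>u. g (z + d u) - u * a z)"
        have zU: "z + d u \<in> cball z0 e" if "u \<in> ball 0 m" for u
          using inU[of t u] t that m unfolding z_def by auto
        have "norm (\<phi> s - \<phi> 0) \<le> \<epsilon> / 2 * norm (s - 0)"
        proof (rule field_differentiable_bound[where f' = "\<lambda>u. a (z + d u) - a z"])
          show "convex (ball (0::complex) m)" by simp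
          show "s \<in> ball 0 m" "0 \<in> ball 0 m" using elim m by auto
          fix u :: complex assume u: "u \<in> ball 0 m"
          show "(\<phi> has_field_derivative a (z + d u) - a z) (at u within ball 0 m)"
            unfolding \<phi>_def
            by (rule has_field_derivative_at_within, rule DERIV_diff[OF deriv_d])
              (use zU[OF u] e in \<open>auto intro!: derivative_eq_intros\<close>)
          have "dist (a (z + d u)) (a z) < \<epsilon> / 2"
            by (rule \<delta>(2)) (use zU[OF u] zU[of 0] d0 m r3(2)[of u] u in \<open>auto simp: dist_norm[of "z + d u"]\<close>)
          then show "norm (a (z + d u) - a z) \<le> \<epsilon> / 2" by (simp add: dist_norm)
        qed
        moreover have "\<phi> 0 = 0"
          using vanish[of t] zU[of 0] m(1) e d0 unfolding \<phi>_def z_def by auto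
        ultimately have "norm (g (z + d s) - s * a z) \<le> \<epsilon> / 2 * norm s"
          unfolding \<phi>_def by simp
        moreover have "g (z + d s) - s * a z = (g (z + d s) / s - a z) * s"
          using elim by (simp add: left_diff_distrib)
        then have "norm (g (z + d s) - s * a z) = norm (g (z + d s) / s - a z) * norm s"
          by (simp only: norm_mult)
        ultimately have "norm (g (z + d s) / s - a z) \<le> \<epsilon> / 2"
          using elim by simp
        then show "dist (g (z0 + d s + c t) / s) (a (z0 + c t)) < \<epsilon>"
          using \<epsilon> unfolding z_def by (simp add: dist_norm algebra_simps)
      qed
    qed
  qed
  have ev: "\<forall>\<^sub>F s in at 0. continuous_on (cball 0 r) (\<lambda>t. g (z0 + d s + c t) / s) \<and>
      (\<forall>w\<in>ball 0 r. ((\<lambda>t. g (z0 + d s + c t) / s) has_field_derivative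
         deriv (\<lambda>t. g (z0 + d s + c t)) w / s) (at w))"
    using near[OF r2(1)]
  proof eventually_elim
    case (elim s)
    have inU': "z0 + d s + c t \<in> U" if "t \<in> cball 0 r" for t
      using inU[of t s] that elim e by (auto simp: algebra_simps)
    show ?case
    proof (intro conjI ballI)
      show "continuous_on (cball 0 r) (\<lambda>t. g (z0 + d s + c t) / s)"
        by (intro continuous_on_divide continuous_at_imp_continuous_on ballI
            field_differentiable_imp_continuous_at holo_c continuous_const)
          (use inU' elim in auto)
      fix w :: complex assume "w \<in> ball 0 r"
      then show "((\<lambda>t. g (z0 + d s + c t) / s) has_field_derivative
         deriv (\<lambda>t. g (z0 + d s + c t)) w / s) (at w)"
        by (intro DERIV_cdivide field_differentiable_derivI holo_c inU') auto
    qed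
  qed
  obtain g' where g': "\<And>w. w \<in> ball 0 r \<Longrightarrow> ((\<lambda>t. a (z0 + c t)) has_field_derivative g' w) (at w)
      \<and> ((\<lambda>s. deriv (\<lambda>t. g (z0 + d s + c t)) w / s) \<longlongrightarrow> g' w) (at 0)"
    by (rule has_complex_derivative_uniform_limit[OF ev ul trivial_limit_at r(1)]) blast
  have g0: "((\<lambda>t. a (z0 + c t)) has_field_derivative g' 0) (at 0)"
    using g'[of 0] r(1) by auto
  then show "(\<lambda>t. a (z0 + c t)) field_differentiable (at 0)"
    by (auto simp: field_differentiable_def)
  show "((\<lambda>s. deriv (\<lambda>t. g (z0 + d s + c t)) 0 / s) \<longlongrightarrow> deriv (\<lambda>t. a (z0 + c t)) 0) (at 0)"
    using g'[of 0] r(1) DERIV_imp_deriv[OF g0] by auto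
qed

subsection \<open>Linearization along \<open>y = 0\<close>\<close>

text \<open>A complex line through the origin. It turns the partial derivatives in
  \<open>x1\<close>, \<open>x2\<close> and each component of \<open>y\<close> into directional
  derivatives, so that the two preceding lemmas cover all of them.\<close>

definition cline :: "complex \<Rightarrow> complex \<Rightarrow> complex^'m \<Rightarrow> complex \<Rightarrow> complex \<times> complex \<times> (complex^'m)" where
  "cline a b v t = (t * a, t * b, t *s v)"

lemma linear_cline: "linear (cline a b v)"
  by (rule linearI) (simp_all add: cline_def vec_eq_iff algebra_simps)

lemma cline_add: "cline a b v (s + t) = cline a b v s + cline a b v t"
  using linear_add[OF linear_cline] .

lemma cline_0 [simp]: "cline a b v 0 = 0"
  using linear_0[OF linear_cline] .

lemma continuous_on_cline: "continuous_on S (cline a b v)"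
  using linear_cline linear_continuous_on linear_conv_bounded_linear by blast

lemma isCont_cline: "isCont (cline a b v) t"
  using continuous_on_cline[of UNIV a b v] by (simp add: continuous_on_eq_continuous_at)

lemma holomorphic_on_multi_imp_continuous_on:
  assumes "holomorphic_on_multi f U"
  shows "continuous_on U f"
  using assms unfolding holomorphic_on_multi_def
  by (blast intro: continuous_at_imp_continuous_on has_derivative_continuous)

text \<open>On a complex line the complex linear Frechet derivative \<open>D\<close> acts as
  multiplication by the number \<open>D (a, b, v) $ i\<close>.\<close>

lemma holomorphic_on_multi_field_differentiable:
  fixes f :: "complex \<times> complex \<times> (complex^'m) \<Rightarrow> complex^'n"
  assumes f: "holomorphic_on_multi f U" and U: "z + cline a b v t \<in> U"
  shows "(\<lambda>t. f (z + cline a b v t) $ i) field_differentiable (at t)"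
proof -
  obtain D where D: "complex_linear D" "(f has_derivative D) (at (z + cline a b v t))"
    using f U unfolding holomorphic_on_multi_def by blast
  have "bounded_linear (cline a b v :: complex \<Rightarrow> complex \<times> complex \<times> (complex^'m))"
    using linear_cline linear_conv_bounded_linear by blast
  then have "((\<lambda>t. z + cline a b v t) has_derivative cline a b v) (at t)"
    by (auto intro!: derivative_eq_intros bounded_linear_imp_has_derivative)
  from has_derivative_compose[OF this D(2)]
  have "((\<lambda>t. f (z + cline a b v t)) has_derivative (\<lambda>h. D (cline a b v h))) (at t)"
    by simp
  then have "((\<lambda>t. f (z + cline a b v t) $ i) has_derivative (\<lambda>h. D (cline a b v h) $ i)) (at t)"
    by (rule bounded_linear.has_derivative[OF bounded_linear_vec_nth])
  moreover have "D (cline a b v h) $ i = D (a, b, v) $ i * h" for h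
    using D(1) unfolding complex_linear_def cline_def by simp
  ultimately show ?thesis
    unfolding field_differentiable_def has_field_derivative_def by auto
qed

lemma partial_x1_cline: "partial_x1 f z $ i = deriv (\<lambda>t. f (z + cline 1 0 0 t) $ i) 0"
proof (cases z)
  case (fields x1 x2 y)
  then show ?thesis
    by (simp add: partial_x1_def cline_def) (subst deriv_shift_0, simp add: o_def)
qed

lemma partial_x2_cline: "partial_x2 f z $ i = deriv (\<lambda>t. f (z + cline 0 1 0 t) $ i) 0"
proof (cases z)
  case (fields x1 x2 y)
  then show ?thesis
    by (simp add: partial_x2_def cline_def) (subst deriv_shift_0, simp add: o_def)
qed

lemma jacobian_y_cline: "jacobian_y f z $ i $ j = deriv (\<lambda>t. f (z + cline 0 0 (axis j 1) t) $ i) 0"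
proof (cases z)
  case (fields x1 x2 y)
  have "(\<chi> k. if k = j then y $ j + t else y $ k) = y + t *s axis j 1" for t
    by (simp add: vec_eq_iff axis_def)
  then show ?thesis
    using fields by (simp add: jacobian_y_def cline_def) (subst deriv_shift_0, simp add: o_def)
qed

lemma continuous_on_jacobian_y:
  fixes f :: "complex \<times> complex \<times> (complex^'m) \<Rightarrow> complex^'n"
  assumes "open U" "holomorphic_on_multi f U"
  shows "continuous_on U (jacobian_y f)"
proof -
  have "continuous_on U (\<lambda>z. jacobian_y f z $ i $ j)" for i j
    unfolding jacobian_y_cline
    by (rule directional_deriv_continuous_on)
      (auto intro!: assms continuous_on_cline continuous_intros holomorphic_on_multi_imp_continuous_on
        holomorphic_on_multi_field_differentiable[OF assms(2)])
  then have "continuous_on U (\<lambda>z. \<chi> i j. jacobian_y f z $ i $ j)"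
    by (intro continuous_on_vec_lambda)
  then show ?thesis by simp
qed

section \<open>Derivatives of the Jacobian along the slice \<open>y = 0\<close>\<close>

definition base_point :: "complex \<times> complex \<Rightarrow> complex \<times> complex \<times> (complex^'m)" where
  "base_point w = (fst w, snd w, 0)"

text \<open>The directions \<open>(0, 1)\<close> and \<open>(1, 0)\<close> give the derivatives of
  \<open>A\<close> in \<open>x2\<close> and of \<open>B\<close> in \<open>x1\<close>.\<close>

definition jacobian_y_deriv ::
    "complex \<Rightarrow> complex \<Rightarrow> (complex \<times> complex \<times> (complex^'m) \<Rightarrow> complex^'n) \<Rightarrow>
     complex \<times> complex \<Rightarrow> complex^'m^'n" where
  "jacobian_y_deriv a b f w = (\<chi> i j. deriv (\<lambda>t. jacobian_y f (base_point (w + (t * a, t * b))) $ i $ j) 0)"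

lemma continuous_on_base_point: "continuous_on S base_point"
  unfolding base_point_def by (intro continuous_intros)

lemma open_base_point_vimage: "open U \<Longrightarrow> open (base_point -` U)"
  by (rule open_vimage[OF _ continuous_on_base_point])

lemma base_point_add: "base_point (w + (t * a, t * b)) = base_point w + cline a b 0 t"
  by (simp add: base_point_def cline_def)

context
  fixes f :: "complex \<times> complex \<times> (complex^'m) \<Rightarrow> complex^'n" and U
  assumes U: "open U" and f: "holomorphic_on_multi f U"
    and vanish: "\<And>w. base_point w \<in> U \<Longrightarrow> f (base_point w) = 0"
begin

text \<open>The mixed derivative lemma with \<open>c\<close> inside the slice, where
  \<open>f\<close> vanishes, and \<open>d\<close> the \<open>j\<close>-th axis of \<open>y\<close>:
  differentiating first in \<open>x\<close> and then in \<open>y\<close> gives the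
  \<open>x\<close>-derivative of the Jacobian.\<close>

lemma
  assumes w: "base_point w \<in> U"
  shows jacobian_y_deriv_limit: "((\<lambda>s. deriv (\<lambda>t. f (base_point w + cline 0 0 (axis j 1) s + cline a b 0 t) $ i) 0 / s)
      \<longlongrightarrow> jacobian_y_deriv a b f w $ i $ j) (at 0)"
    and jacobian_y_differentiable_0: "(\<lambda>t. jacobian_y f (base_point w + cline a b 0 t) $ i $ j) field_differentiable (at 0)"
proof -
  have 1: "continuous_on U (\<lambda>z. f z $ i)"
    by (intro continuous_intros holomorphic_on_multi_imp_continuous_on[OF f])
  have 2: "f (base_point w + cline a b 0 t) $ i = 0" if "base_point w + cline a b 0 t \<in> U" for t
    using that vanish by (metis base_point_add zero_index)
  note L = mixed_directional_deriv_limit[where g = "\<lambda>z. f z $ i" and ?z0.0 = "base_point w"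
      and c = "cline a b 0" and d = "cline 0 0 (axis j 1)", OF U 1 w continuous_on_cline cline_0
        continuous_on_cline cline_add holomorphic_on_multi_field_differentiable[OF f]
        holomorphic_on_multi_field_differentiable[OF f] 2]
  show "((\<lambda>s. deriv (\<lambda>t. f (base_point w + cline 0 0 (axis j 1) s + cline a b 0 t) $ i) 0 / s)
      \<longlongrightarrow> jacobian_y_deriv a b f w $ i $ j) (at 0)"
    using L(1) by (simp add: jacobian_y_deriv_def jacobian_y_cline base_point_add)
  show "(\<lambda>t. jacobian_y f (base_point w + cline a b 0 t) $ i $ j) field_differentiable (at 0)"
    using L(2) by (simp add: jacobian_y_cline)
qed

text \<open>Translation along the line extends differentiability from 0 to every \<open>t\<close>,
  the form in which \<open>directional_deriv_continuous_on\<close> can be applied to the Jacobian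
  itself.\<close>

lemma jacobian_y_differentiable:
  assumes w: "base_point (w + (t * a, t * b)) \<in> U"
  shows "(\<lambda>t. jacobian_y f (base_point (w + (t * a, t * b))) $ i $ j) field_differentiable (at t)"
proof -
  obtain D where "((\<lambda>s. jacobian_y f (base_point (w + (t * a, t * b)) + cline a b 0 s) $ i $ j)
      has_field_derivative D) (at 0)"
    using jacobian_y_differentiable_0[OF w] unfolding field_differentiable_def by blast
  moreover have "base_point (w + (t * a, t * b)) + cline a b 0 s
      = (base_point (w + ((s + t) * a, (s + t) * b)) :: complex \<times> complex \<times> (complex^'m))" for s
    unfolding base_point_add by (simp add: cline_add)
  ultimately have "((\<lambda>s. jacobian_y f (base_point (w + ((s + t) * a, (s + t) * b))) $ i $ j)
      has_field_derivative D) (at 0)"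
    by simp
  then have "((\<lambda>t. jacobian_y f (base_point (w + (t * a, t * b))) $ i $ j) has_field_derivative D) (at t)"
    using DERIV_shift[of "\<lambda>t. jacobian_y f (base_point (w + (t * a, t * b))) $ i $ j" D 0 t]
    by (simp only: add_0_left)
  then show ?thesis unfolding field_differentiable_def by blast
qed

lemma continuous_on_jacobian_y_base_point:
  "continuous_on (base_point -` U) (\<lambda>w. jacobian_y f (base_point w))"
  by (rule continuous_on_compose2[OF continuous_on_jacobian_y[OF U f] continuous_on_base_point]) auto

lemma continuous_on_jacobian_y_deriv: "continuous_on (base_point -` U) (jacobian_y_deriv a b f)"
  unfolding jacobian_y_deriv_def
proof (intro continuous_on_vec_lambda)
  fix i j
  show "continuous_on (base_point -` U) (\<lambda>w. deriv (\<lambda>t. jacobian_y f (base_point (w + (t * a, t * b))) $ i $ j) 0)"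
    by (rule directional_deriv_continuous_on[where c = "\<lambda>t. (t * a, t * b)" and
          g = "\<lambda>w. jacobian_y f (base_point w) $ i $ j"])
      (auto intro!: open_base_point_vimage U continuous_intros continuous_on_jacobian_y_base_point
        jacobian_y_differentiable simp: zero_prod_def)
qed

lemma jacobian_y_limit:
  assumes w: "base_point w \<in> U"
  shows "((\<lambda>s. f (base_point w + cline 0 0 (axis j 1) s) $ i / s) \<longlongrightarrow> jacobian_y f (base_point w) $ i $ j) (at 0)"
proof -
  have "((\<lambda>s. f (base_point w + cline 0 0 (axis j 1) s) $ i) has_field_derivative
      jacobian_y f (base_point w) $ i $ j) (at 0)"
    unfolding jacobian_y_cline
    by (rule field_differentiable_derivI, rule holomorphic_on_multi_field_differentiable[OF f]) (use w in simp)
  then show ?thesis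
    using vanish[OF w] by (simp add: has_field_derivative_iff)
qed

end

text \<open>Evaluate the integrability condition at \<open>y = s *s axis j 1\<close>, divide
  component \<open>i\<close> by \<open>s\<close> and let \<open>s\<close> tend to 0.\<close>

lemma linearized_integrability:
  fixes f1 f2 :: "complex \<times> complex \<times> (complex ^ 'l) \<Rightarrow> complex ^ 'l"
  assumes U: "open U" and f1: "holomorphic_on_multi f1 U" and f2: "holomorphic_on_multi f2 U"
    and ci: "completely_integrable p q p' q' f1 f2 U"
    and w: "base_point (x1, x2) \<in> U"
  defines "A \<equiv> jacobian_y f1 (base_point (x1, x2))" and "B \<equiv> jacobian_y f2 (base_point (x1, x2))"
    and "A2 \<equiv> jacobian_y_deriv 0 1 f1 (x1, x2)" and "B1 \<equiv> jacobian_y_deriv 1 0 f2 (x1, x2)"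
  shows "(- of_nat q * x1 ^ p' * x2 ^ q') * A $ i $ j + (x1 ^ p' * x2 ^ (q' + 1)) * A2 $ i $ j + (A ** B) $ i $ j
    = (- of_nat p' * x1 ^ p * x2 ^ q) * B $ i $ j + (x1 ^ (p + 1) * x2 ^ q) * B1 $ i $ j + (B ** A) $ i $ j"
proof -
  let ?z = "\<lambda>s. base_point (x1, x2) + cline 0 0 (axis j 1) s"
  have v1: "f1 (base_point w) = 0" and v2: "f2 (base_point w) = 0" if "base_point w \<in> U" for w
    using ci that unfolding completely_integrable_def base_point_def by auto
  have zU: "\<forall>\<^sub>F s in at 0. ?z s \<in> U"
  proof -
    have "isCont ?z 0"
      by (intro continuous_intros isCont_cline)
    then have "(?z \<longlongrightarrow> base_point (x1, x2)) (at 0)" by (simp add: isCont_def)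
    then show ?thesis using U w by (rule topological_tendstoD)
  qed
  have jac: "((\<lambda>s. jacobian_y f (?z s)) \<longlongrightarrow> jacobian_y f (base_point (x1, x2))) (at 0)"
    if "holomorphic_on_multi f U" for f :: "complex \<times> complex \<times> (complex ^ 'l) \<Rightarrow> complex ^ 'l"
  proof -
    have "isCont (jacobian_y f) (base_point (x1, x2))"
      using continuous_on_jacobian_y[OF U that] U w continuous_on_eq_continuous_at by blast
    moreover have "isCont ?z 0"
      by (intro continuous_intros isCont_cline)
    ultimately have "isCont (\<lambda>s. jacobian_y f (?z s)) 0"
      by (intro continuous_at_compose[where g = "jacobian_y f" and f = ?z, unfolded o_def]) simp_all
    then show ?thesis by (simp add: isCont_def)
  qed
  \<comment> \<open>The division by \<open>s\<close> is absorbed by \<open>g\<close>, which vanishes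
    on the slice; for the Jacobian factor continuity is enough.\<close>
  have prod: "((\<lambda>s. (jacobian_y f (?z s) *v g (?z s)) $ i / s) \<longlongrightarrow>
      (jacobian_y f (base_point (x1, x2)) ** jacobian_y g (base_point (x1, x2))) $ i $ j) (at 0)"
    if "holomorphic_on_multi f U" "holomorphic_on_multi g U" "\<And>w. base_point w \<in> U \<Longrightarrow> g (base_point w) = 0"
    for f g :: "complex \<times> complex \<times> (complex ^ 'l) \<Rightarrow> complex ^ 'l"
  proof -
    have "((\<lambda>s. \<Sum>k\<in>UNIV. jacobian_y f (?z s) $ i $ k * (g (?z s) $ k / s)) \<longlongrightarrow>
      (\<Sum>k\<in>UNIV. jacobian_y f (base_point (x1, x2)) $ i $ k * jacobian_y g (base_point (x1, x2)) $ k $ j)) (at 0)"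
      by (intro tendsto_intros jac that(1) jacobian_y_limit[OF U that(2,3) w])
    then show ?thesis
      by (simp add: matrix_vector_mult_def matrix_matrix_mult_def sum_divide_distrib)
  qed
  let ?L = "\<lambda>s. (- of_nat q * x1 ^ p' * x2 ^ q') * (f1 (?z s) $ i / s)
      + (x1 ^ p' * x2 ^ (q' + 1)) * (deriv (\<lambda>t. f1 (?z s + cline 0 1 0 t) $ i) 0 / s)
      + (jacobian_y f1 (?z s) *v f2 (?z s)) $ i / s"
  let ?R = "\<lambda>s. (- of_nat p' * x1 ^ p * x2 ^ q) * (f2 (?z s) $ i / s)
      + (x1 ^ (p + 1) * x2 ^ q) * (deriv (\<lambda>t. f2 (?z s + cline 1 0 0 t) $ i) 0 / s)
      + (jacobian_y f2 (?z s) *v f1 (?z s)) $ i / s"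
  have L: "(?L \<longlongrightarrow> (- of_nat q * x1 ^ p' * x2 ^ q') * A $ i $ j + (x1 ^ p' * x2 ^ (q' + 1)) * A2 $ i $ j + (A ** B) $ i $ j) (at 0)"
    unfolding A_def B_def A2_def
    by (intro tendsto_add tendsto_mult tendsto_const jacobian_y_limit[OF U f1 v1 w]
        jacobian_y_deriv_limit[OF U f1 v1 w] prod[OF f1 f2 v2])
  have R: "(?R \<longlongrightarrow> (- of_nat p' * x1 ^ p * x2 ^ q) * B $ i $ j + (x1 ^ (p + 1) * x2 ^ q) * B1 $ i $ j + (B ** A) $ i $ j) (at 0)"
    unfolding A_def B_def B1_def
    by (intro tendsto_add tendsto_mult tendsto_const jacobian_y_limit[OF U f2 v2 w]
        jacobian_y_deriv_limit[OF U f2 v2 w] prod[OF f2 f1 v1])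
  have "\<forall>\<^sub>F s in at 0. ?L s = ?R s"
    using zU
  proof eventually_elim
    case (elim s)
    let ?y = "s *s axis j 1 :: complex^'l"
    have z: "?z s = (x1, x2, ?y)" by (simp add: base_point_def cline_def)
    have "((- of_nat q * x1 ^ p' * x2 ^ q') *s f1 (x1, x2, ?y)
          + (x1 ^ p' * x2 ^ (q' + 1)) *s partial_x2 f1 (x1, x2, ?y)
          + jacobian_y f1 (x1, x2, ?y) *v f2 (x1, x2, ?y)) $ i
        = ((- of_nat p' * x1 ^ p * x2 ^ q) *s f2 (x1, x2, ?y)
          + (x1 ^ (p + 1) * x2 ^ q) *s partial_x1 f2 (x1, x2, ?y)
          + jacobian_y f2 (x1, x2, ?y) *v f1 (x1, x2, ?y)) $ i"
      using ci elim unfolding completely_integrable_def z by metis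
    then show ?case
      unfolding z[symmetric] vector_add_component vector_smult_component partial_x1_cline partial_x2_cline
        times_divide_eq_right add_divide_distrib[symmetric]
      by simp
  qed
  then have "(?R \<longlongrightarrow> (- of_nat q * x1 ^ p' * x2 ^ q') * A $ i $ j + (x1 ^ p' * x2 ^ (q' + 1)) * A2 $ i $ j + (A ** B) $ i $ j) (at 0)"
    using L tendsto_cong by force
  then show ?thesis using R tendsto_unique[OF trivial_limit_at] by blast
qed

subsection \<open>Traces and comparison of monomials\<close>

lemma trace_mult: "trace (X ** M) = (\<Sum>i\<in>UNIV. \<Sum>j\<in>UNIV. X $ i $ j * M $ j $ i)"
  by (simp add: trace_def matrix_matrix_mult_def)

text \<open>\<open>X Y Z = Y X Z\<close>, and rotating \<open>Y\<close> to the end leaves the trace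
  unchanged. This is the vanishing of the trace of \<open>X (Y Z - Z Y)\<close>.\<close>

lemma trace_mult_commutator:
  fixes X Y Z :: "complex^'n^'n"
  assumes "X ** Y = Y ** X"
  shows "trace (X ** (Y ** Z)) = trace (X ** (Z ** Y))"
  by (metis assms matrix_mul_assoc trace_mul_sym)

lemma matrix_power_commute: "M ** matrix_power M k = matrix_power M k ** M"
proof (induction k)
  case (Suc k)
  then show ?case by (metis matrix_mul_assoc matrix_power_simps(2))
qed simp

section \<open>Continuity of matrix expressions and cancellation of monomials\<close>

lemma continuous_on_matrix_mult:
  fixes F G :: "'a::topological_space \<Rightarrow> complex^'n^'n"
  assumes "continuous_on S F" "continuous_on S G"
  shows "continuous_on S (\<lambda>x. F x ** G x)"
  unfolding matrix_matrix_mult_def by (intro continuous_intros assms)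

lemma continuous_on_trace:
  fixes F :: "'a::topological_space \<Rightarrow> complex^'n^'n"
  assumes "continuous_on S F"
  shows "continuous_on S (\<lambda>x. trace (F x))"
  unfolding trace_def by (intro continuous_intros assms)

lemma continuous_on_matrix_power:
  fixes F :: "'a::topological_space \<Rightarrow> complex^'n^'n"
  assumes "continuous_on S F"
  shows "continuous_on S (\<lambda>x. matrix_power (F x) k)"
  by (induction k) (simp_all add: continuous_on_matrix_mult assms)

lemma continuous_zero_at_centre:
  fixes \<phi> :: "complex \<Rightarrow> complex"
  assumes "continuous_on (ball 0 e) \<phi>" "e > 0" "\<And>t. t \<in> ball 0 e - {0} \<Longrightarrow> \<phi> t = 0"
  shows "\<phi> 0 = 0"
proof -
  have "isCont \<phi> 0"
    using assms(1,2) by (simp add: continuous_on_eq_continuous_at)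
  then have "(\<phi> \<longlongrightarrow> \<phi> 0) (at 0)" by (simp add: isCont_def)
  moreover have "\<forall>\<^sub>F t in at 0. \<phi> t = 0"
    by (rule eventually_mono[OF eventually_at_in_open[of "ball 0 e"]]) (use assms in auto)
  then have "(\<phi> \<longlongrightarrow> 0) (at 0)" by (simp add: tendsto_eventually)
  ultimately show ?thesis using tendsto_unique[OF trivial_limit_at] by blast
qed

text \<open>For fixed nonzero \<open>y\<close>, cancelling \<open>x ^ a'\<close> leaves a positive
  power of \<open>x\<close> on the right, so \<open>R (0, y) = 0\<close>; then \<open>y\<close>
  tends to 0.\<close>

lemma monomial_comparison_fst:
  fixes R S :: "complex \<times> complex \<Rightarrow> complex"
  assumes V: "open V" "(0, 0) \<in> V" and cont: "continuous_on V R" "continuous_on V S"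
    and eq: "\<And>x y. (x, y) \<in> V \<Longrightarrow> x ^ a' * y ^ b' * R (x, y) = x ^ a * y ^ b * S (x, y)"
    and a: "a' < a"
  shows "R (0, 0) = 0"
proof -
  obtain V1 V2 where V12: "open V1" "open V2" "0 \<in> V1" "0 \<in> V2" "V1 \<times> V2 \<subseteq> V"
    using open_prod_elim[OF V] by (metis mem_Sigma_iff)
  obtain e1 e2 where e12: "e1 > 0" "e2 > 0" "ball 0 e1 \<subseteq> V1" "ball 0 e2 \<subseteq> V2"
    using V12 open_contains_ball by metis
  have sub: "x \<in> ball 0 e1 \<Longrightarrow> y \<in> ball 0 e2 \<Longrightarrow> (x, y) \<in> V" for x y
    using V12 e12 by blast
  have "R (0, y) = 0" if y: "y \<in> ball 0 e2 - {0}" for y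
  proof -
    \<comment> \<open>The difference of the two sides after cancelling \<open>t ^ a'\<close>: zero
      for \<open>t \<noteq> 0\<close> and continuous at 0, hence zero there too.\<close>
    define \<phi> where "\<phi> = (\<lambda>t. y ^ b' * R (t, y) - t ^ (a - a') * y ^ b * S (t, y))"
    have "\<phi> 0 = 0"
    proof (rule continuous_zero_at_centre)
      show "continuous_on (ball 0 e1) \<phi>"
        unfolding \<phi>_def
        by (intro continuous_intros continuous_on_compose2[OF cont(1)] continuous_on_compose2[OF cont(2)])
          (use sub y in auto)
      show "e1 > 0" by fact
      fix t :: complex assume t: "t \<in> ball 0 e1 - {0}"
      have "t ^ a' * \<phi> t = t ^ a' * y ^ b' * R (t, y) - t ^ (a' + (a - a')) * y ^ b * S (t, y)"
        by (simp add: \<phi>_def algebra_simps power_add)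
      also have "\<dots> = 0" using eq[OF sub[of t y]] t y a by simp
      finally show "\<phi> t = 0" using t by simp
    qed
    then show ?thesis using a y by (simp add: \<phi>_def power_0_left)
  qed
  then show ?thesis
    by (intro continuous_zero_at_centre[of e2 "\<lambda>y. R (0, y)"] continuous_on_compose2[OF cont(1)])
      (use sub e12 in \<open>auto intro!: continuous_intros\<close>)
qed

text \<open>The case \<open>b' < b\<close> reduces to the previous lemma by exchanging the two
  coordinates.\<close>

lemma monomial_comparison:
  fixes R S :: "complex \<times> complex \<Rightarrow> complex"
  assumes V: "open V" "(0, 0) \<in> V" and cont: "continuous_on V R" "continuous_on V S"
    and eq: "\<And>x y. (x, y) \<in> V \<Longrightarrow> x ^ a' * y ^ b' * R (x, y) = x ^ a * y ^ b * S (x, y)"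
    and ab: "a' < a \<or> b' < b"
  shows "R (0, 0) = 0"
proof (cases "a' < a")
  case True
  show ?thesis by (rule monomial_comparison_fst[OF V cont eq True])
next
  case False
  have sw: "continuous_on (prod.swap -` V) prod.swap"
    by (rule continuous_on_swap)
  have "(R \<circ> prod.swap) (0, 0) = 0"
  proof (rule monomial_comparison_fst)
    show "open (prod.swap -` V)" using V(1) by (rule open_vimage) (rule continuous_on_swap)
    show "continuous_on (prod.swap -` V) (R \<circ> prod.swap)" "continuous_on (prod.swap -` V) (S \<circ> prod.swap)"
      by (auto simp: o_def intro!: continuous_on_compose2[OF cont(1) sw] continuous_on_compose2[OF cont(2) sw])
    show "b' < b" using ab False by blast
    show "x ^ b' * y ^ a' * (R \<circ> prod.swap) (x, y) = x ^ b * y ^ a * (S \<circ> prod.swap) (x, y)"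
      if "(x, y) \<in> prod.swap -` V" for x y
      using eq[of y x] that by (simp add: mult_ac)
  qed (use V in auto)
  then show ?thesis by simp
qed

subsection \<open>Generalized eigenspaces\<close>

lemma mat_mult_vector: "mat c *v v = c *s v"
  for v :: "'a::semiring_1^'n"
  by (simp add: matrix_vector_mult_def mat_def vec_eq_iff if_distrib[where f = "\<lambda>x. x * _"] cong: if_cong)

lemma matrix_power_mult_vector_commute:
  fixes M N :: "'a::field^'n^'n"
  assumes "\<And>v. M *v (N *v v) = N *v (M *v v)"
  shows "matrix_power M k *v (N *v v) = N *v (matrix_power M k *v v)"
proof (induction k)
  case (Suc k)
  then show ?case by (simp add: matrix_vector_mul_assoc[symmetric] assms)
qed simp

lemma matrix_power_mult_vector_0:
  fixes M :: "'a::field^'n^'n"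
  assumes "matrix_power M k *v v = 0" "k \<le> l"
  shows "matrix_power M l *v v = 0"
proof -
  have "matrix_power M l = matrix_power M (l - k) ** matrix_power M k"
    using assms(2) by (simp add: matrix_power_add[symmetric])
  then show ?thesis using assms(1) by (simp add: matrix_vector_mul_assoc[symmetric])
qed

text \<open>\<open>A\<close> commutes with the powers of \<open>B - mat \<mu>\<close> and so
  preserves their kernels. These kernels increase with the exponent, so their union is a
  subspace.\<close>

lemma invariant_subspace_generalized_eigenspace:
  fixes A B :: "'a::field^'n^'n"
  assumes comm: "A ** B = B ** A"
  shows "invariant_subspace A (generalized_eigenspace B \<mu>)"
  unfolding invariant_subspace_def
proof
  let ?M = "B - mat \<mu>"
  have "?M *v (A *v v) = A *v (?M *v v)" for v
  proof -
    have "A *v (B *v v) = B *v (A *v v)" by (simp add: matrix_vector_mul_assoc comm)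
    then show ?thesis
      by (simp add: matrix_vector_mult_diff_rdistrib matrix_vector_mult_diff_distrib mat_mult_vector
          vector_scalar_commute)
  qed
  then show "\<forall>v\<in>generalized_eigenspace B \<mu>. A *v v \<in> generalized_eigenspace B \<mu>"
    unfolding generalized_eigenspace_def
    by (auto simp: matrix_power_mult_vector_commute) (metis matrix_vector_mult_0_right)
  show "vec.subspace (generalized_eigenspace B \<mu>)"
  proof (rule vec.subspaceI)
    show "0 \<in> generalized_eigenspace B \<mu>" by (simp add: generalized_eigenspace_def)
    fix v w assume "v \<in> generalized_eigenspace B \<mu>" "w \<in> generalized_eigenspace B \<mu>"
    then obtain k l where "matrix_power ?M k *v v = 0" "matrix_power ?M l *v w = 0"
      by (auto simp: generalized_eigenspace_def)
    then have "matrix_power ?M (max k l) *v v = 0" "matrix_power ?M (max k l) *v w = 0"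
      by (auto intro: matrix_power_mult_vector_0)
    then have "matrix_power ?M (max k l) *v (v + w) = 0"
      by (simp add: matrix_vector_right_distrib)
    then show "v + w \<in> generalized_eigenspace B \<mu>" by (auto simp: generalized_eigenspace_def)
  next
    fix c v assume "v \<in> generalized_eigenspace B \<mu>"
    then show "c *s v \<in> generalized_eigenspace B \<mu>"
      by (auto simp: generalized_eigenspace_def vector_scalar_commute)
  qed
qed

lemma eigenvector_in_generalized_eigenspace:
  assumes "B *v v = \<mu> *s v"
  shows "v \<in> generalized_eigenspace B \<mu>"
proof -
  have "matrix_power (B - mat \<mu>) 1 *v v = 0"
    using assms by (simp add: matrix_vector_mult_diff_rdistrib mat_mult_vector)
  then show ?thesis unfolding generalized_eigenspace_def by blast
qed

text \<open>Take the last nonzero vector among \<open>v\<close>, \<open>N v\<close>,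
  \<open>N N v\<close> and so on. Since \<open>N\<close> commutes with \<open>B\<close>, all of them
  satisfy the eigenvalue equation for \<open>\<mu>\<close>.\<close>

lemma nilpotent_kernel_in_eigenspace:
  fixes N B :: "'a::field^'n^'n"
  assumes nil: "nilpotent_matrix N" and comm: "N ** B = B ** N"
    and v: "v \<noteq> 0" "B *v v = \<mu> *s v"
  obtains u where "u \<noteq> 0" "B *v u = \<mu> *s u" "N *v u = 0"
proof -
  obtain m where "matrix_power N m *v v = 0"
    using nil unfolding nilpotent_matrix_def by (metis matrix_vector_mult_0)
  then obtain k where k: "matrix_power N k *v v = 0" "\<And>j. j < k \<Longrightarrow> matrix_power N j *v v \<noteq> 0"
    using exists_least_iff[of "\<lambda>k. matrix_power N k *v v = 0"] by blast
  then obtain j where j: "k = Suc j" using v(1) by (cases k) auto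
  define u where "u = matrix_power N j *v v"
  have "matrix_power N j *v (B *v v) = B *v (matrix_power N j *v v)"
    by (rule matrix_power_mult_vector_commute) (simp add: matrix_vector_mul_assoc comm)
  then have "B *v u = \<mu> *s u"
    by (simp add: u_def v(2) vector_scalar_commute)
  moreover have "u \<noteq> 0" "N *v u = 0"
    using k j by (auto simp: u_def matrix_vector_mul_assoc)
  ultimately show ?thesis using that by blast
qed

section \<open>Nilpotency and the eigenvalue relation at the origin\<close>

theorem theorem4p4:
  fixes p q p' q' :: nat
    and f1 f2 :: "complex \<times> complex \<times> (complex ^ 'l) \<Rightarrow> complex ^ 'l"
    and U :: "(complex \<times> complex \<times> (complex ^ 'l)) set"
    and A B :: "complex \<Rightarrow> complex \<Rightarrow> complex ^ 'l ^ 'l"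
  assumes "p > 0" and "q > 0" and "p' > 0" and "q' > 0"
    and "open U" and "(0, 0, 0) \<in> U"
    and "holomorphic_on_multi f1 U" and "holomorphic_on_multi f2 U"
    and "completely_integrable p q p' q' f1 f2 U"
    and "\<And>x1 x2. A x1 x2 = jacobian_y f1 (x1, x2, 0)"
    and "\<And>x1 x2. B x1 x2 = jacobian_y f2 (x1, x2, 0)"
  shows "(p' < p \<or> q' < q \<longrightarrow> nilpotent_matrix (A 0 0)) \<and>
         (p < p' \<or> q < q' \<longrightarrow> nilpotent_matrix (B 0 0)) \<and>
         (p = p' \<and> q = q' \<longrightarrow>
           (\<forall>\<mu>. eigenvalue_of (B 0 0) \<mu> \<longrightarrow>
             invariant_subspace (A 0 0) (generalized_eigenspace (B 0 0) \<mu>) \<and>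
             (\<exists>lam. eigenvalue_of (A 0 0) lam \<and>
                  of_nat q * lam = of_nat p * \<mu> \<and>
                  eigenvalue_of_restriction (A 0 0) (generalized_eigenspace (B 0 0) \<mu>) lam)))"
proof -
  define V where "V = base_point -` U"
  define \<A> where "\<A> w = jacobian_y f1 (base_point w)" for w
  define \<B> where "\<B> w = jacobian_y f2 (base_point w)" for w
  define \<A>2 where "\<A>2 = jacobian_y_deriv 0 1 f1"
  define \<B>1 where "\<B>1 = jacobian_y_deriv 1 0 f2"
  \<comment> \<open>\<open>R\<close> and \<open>S\<close> are the factors left after extracting the
    monomials: the trace of \<open>X (A B - B A)\<close> is
    \<open>x1^p' x2^q' R - x1^p x2^q S\<close>.\<close>
  define R where "R X w = of_nat q * trace (X w ** \<A> w) - snd w * trace (X w ** \<A>2 w)"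
    for X :: "complex \<times> complex \<Rightarrow> complex ^ 'l ^ 'l" and w
  define S where "S X w = of_nat p' * trace (X w ** \<B> w) - fst w * trace (X w ** \<B>1 w)"
    for X :: "complex \<times> complex \<Rightarrow> complex ^ 'l ^ 'l" and w
  have vanish: "f1 (base_point w) = 0" "f2 (base_point w) = 0" if "base_point w \<in> U" for w
    using assms(9) that unfolding completely_integrable_def base_point_def by auto
  have V: "open V" "(0, 0) \<in> V"
    using open_base_point_vimage assms(5,6) by (auto simp: V_def base_point_def)
  have AB0: "A 0 0 = \<A> (0, 0)" "B 0 0 = \<B> (0, 0)"
    by (simp_all add: assms(10,11) \<A>_def \<B>_def base_point_def)
  have cont: "continuous_on V \<A>" "continuous_on V \<B>" "continuous_on V \<A>2" "continuous_on V \<B>1"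
    unfolding V_def \<A>_def \<B>_def \<A>2_def \<B>1_def
    by (intro continuous_on_jacobian_y_base_point[OF assms(5,7) vanish(1)]
        continuous_on_jacobian_y_base_point[OF assms(5,8) vanish(2)]
        continuous_on_jacobian_y_deriv[OF assms(5,7) vanish(1)]
        continuous_on_jacobian_y_deriv[OF assms(5,8) vanish(2)]; assumption)+
  have contR: "continuous_on V (R X)" "continuous_on V (S X)" if "continuous_on V X" for X
    unfolding R_def S_def
    by (intro continuous_intros continuous_on_trace continuous_on_matrix_mult cont that)+
  have lin: "(- of_nat q * x ^ p' * y ^ q') * \<A> (x, y) $ i $ j + (x ^ p' * y ^ (q' + 1)) * \<A>2 (x, y) $ i $ j
        + (\<A> (x, y) ** \<B> (x, y)) $ i $ j
      = (- of_nat p' * x ^ p * y ^ q) * \<B> (x, y) $ i $ j + (x ^ (p + 1) * y ^ q) * \<B>1 (x, y) $ i $ j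
        + (\<B> (x, y) ** \<A> (x, y)) $ i $ j" if "(x, y) \<in> V" for x y i j
    unfolding \<A>_def \<B>_def \<A>2_def \<B>1_def
    by (rule linearized_integrability[OF assms(5,7,8,9)]) (use that V_def in simp)
  have lin_tr: "x ^ p' * y ^ q' * R X (x, y) + trace (X (x, y) ** (\<B> (x, y) ** \<A> (x, y)))
      = x ^ p * y ^ q * S X (x, y) + trace (X (x, y) ** (\<A> (x, y) ** \<B> (x, y)))"
    if "(x, y) \<in> V" for x y X
  proof -
    have entry: "x ^ p' * y ^ q' * (of_nat q * \<A> (x, y) $ i $ j - y * \<A>2 (x, y) $ i $ j)
          + (\<B> (x, y) ** \<A> (x, y)) $ i $ j
        = x ^ p * y ^ q * (of_nat p' * \<B> (x, y) $ i $ j - x * \<B>1 (x, y) $ i $ j)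
          + (\<A> (x, y) ** \<B> (x, y)) $ i $ j" for i j
      using lin[OF that, of i j] by (simp add: algebra_simps)
    \<comment> \<open>Brings both sides into the form of one double sum against the entries of
      \<open>X\<close>, into which the entrywise identity can be substituted.\<close>
    have comb: "c * (a * trace (Y ** M) - b * trace (Y ** M')) + trace (Y ** L)
        = (\<Sum>i\<in>UNIV. \<Sum>j\<in>UNIV. Y $ i $ j * (c * (a * M $ j $ i - b * M' $ j $ i) + L $ j $ i))"
      for a b c :: complex and Y M M' L :: "complex ^ 'l ^ 'l"
      unfolding trace_mult
      by (simp add: sum_distrib_left sum.distrib sum_subtractf algebra_simps)
    show ?thesis unfolding R_def S_def fst_conv snd_conv comb entry ..
  qed
  have nilA: "nilpotent_matrix (A 0 0)" if "p' < p \<or> q' < q"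
  proof (rule nilpotent_if_traces_zero)
    fix k
    let ?X = "\<lambda>w. matrix_power (\<A> w) k"
    have "R ?X (0, 0) = 0"
    proof (rule monomial_comparison[OF V contR(1) contR(2) _ that])
      show "x ^ p' * y ^ q' * R ?X (x, y) = x ^ p * y ^ q * S ?X (x, y)" if "(x, y) \<in> V" for x y
        using lin_tr[OF that, of ?X]
          trace_mult_commutator[OF matrix_power_commute[symmetric], of "\<A> (x, y)" k "\<B> (x, y)"]
        by simp
    qed (intro continuous_on_matrix_power cont)+
    \<comment> \<open>At the origin \<open>snd w = 0\<close> removes the derivative term, so
      \<open>R\<close> is \<open>q\<close> times this trace, and \<open>q\<close> is
      nonzero.\<close>
    then show "trace (matrix_power (A 0 0) (Suc k)) = 0"
      using assms(2) by (simp add: R_def AB0 matrix_power_commute)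
  qed
  have nilB: "nilpotent_matrix (B 0 0)" if "p < p' \<or> q < q'"
  proof (rule nilpotent_if_traces_zero)
    fix k
    let ?X = "\<lambda>w. matrix_power (\<B> w) k"
    have "S ?X (0, 0) = 0"
    proof (rule monomial_comparison[OF V contR(2) contR(1) _ that])
      show "x ^ p * y ^ q * S ?X (x, y) = x ^ p' * y ^ q' * R ?X (x, y)" if "(x, y) \<in> V" for x y
        using lin_tr[OF that, of ?X]
          trace_mult_commutator[OF matrix_power_commute[symmetric], of "\<B> (x, y)" k "\<A> (x, y)"]
        by simp
    qed (intro continuous_on_matrix_power cont)+
    then show "trace (matrix_power (B 0 0) (Suc k)) = 0"
      using assms(3) by (simp add: S_def AB0 matrix_power_commute)
  qed
  \<comment> \<open>All four exponents are positive, so at the origin every monomial vanishes and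
    only the commutator remains.\<close>
  have comm: "A 0 0 ** B 0 0 = B 0 0 ** A 0 0"
    using lin[OF V(2)] assms(1-4) by (simp add: vec_eq_iff AB0 power_0_left)
  have eig: "\<exists>lam. eigenvalue_of (A 0 0) lam \<and> of_nat q * lam = of_nat p * \<mu> \<and>
      eigenvalue_of_restriction (A 0 0) (generalized_eigenspace (B 0 0) \<mu>) lam"
    if pq: "p = p'" "q = q'" and \<mu>: "eigenvalue_of (B 0 0) \<mu>" for \<mu>
  proof -
    \<comment> \<open>Real scalars are used so that the real linearity of products and trace applies
      directly.\<close>
    define Y where "Y w = real q *\<^sub>R \<A> w - real p *\<^sub>R \<B> w" for w
    have Y_left: "Y w ** Z = real q *\<^sub>R (\<A> w ** Z) - real p *\<^sub>R (\<B> w ** Z)" for w and Z :: "complex ^ 'l ^ 'l"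
      by (simp add: Y_def linear_diff[OF linear_matrix_mult_right] linear_cmul[OF linear_matrix_mult_right])
    have Y_right: "Z ** Y w = real q *\<^sub>R (Z ** \<A> w) - real p *\<^sub>R (Z ** \<B> w)" for w and Z :: "complex ^ 'l ^ 'l"
      by (simp add: Y_def linear_diff[OF linear_matrix_mult_left] linear_cmul[OF linear_matrix_mult_left])
    have contY: "continuous_on V Y"
      unfolding Y_def by (intro continuous_intros cont)
    have "nilpotent_matrix (Y (0, 0))"
    proof (rule nilpotent_if_traces_zero)
      fix k
      let ?X = "\<lambda>w. matrix_power (Y w) k"
      have contX: "continuous_on V ?X" by (intro continuous_on_matrix_power contY)
      \<comment> \<open>For equal exponents both terms carry the same monomial. Comparing with the
        zero function at higher exponents cancels it.\<close>
      have "(\<lambda>w. R ?X w - S ?X w) (0, 0) = 0"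
      proof (rule monomial_comparison[OF V, where S = "\<lambda>_. 0"])
        show "p < Suc p \<or> q < Suc q" by simp
        show "x ^ p * y ^ q * (R ?X (x, y) - S ?X (x, y)) = x ^ Suc p * y ^ Suc q * 0"
          if "(x, y) \<in> V" for x y
        proof -
          let ?w = "(x, y)"
          \<comment> \<open>Since \<open>B\<close> commutes with itself, the commutator of
            \<open>Y\<close> and \<open>B\<close> is \<open>q\<close> times that of \<open>A\<close>
            and \<open>B\<close>; hence its trace against a power of \<open>Y\<close> also
            vanishes.\<close>
          have "trace (?X ?w ** (Y ?w ** \<B> ?w)) = trace (?X ?w ** (\<B> ?w ** Y ?w))"
            by (rule trace_mult_commutator) (rule matrix_power_commute[symmetric])
          then have "real q *\<^sub>R trace (?X ?w ** (\<A> ?w ** \<B> ?w)) = real q *\<^sub>R trace (?X ?w ** (\<B> ?w ** \<A> ?w))"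
            unfolding Y_left Y_right
            by (simp add: linear_diff[OF linear_matrix_mult_left] linear_cmul[OF linear_matrix_mult_left]
                linear_diff[OF linear_trace] linear_cmul[OF linear_trace])
          then have "trace (?X ?w ** (\<A> ?w ** \<B> ?w)) = trace (?X ?w ** (\<B> ?w ** \<A> ?w))"
            using assms(2) by simp
          then show ?thesis using lin_tr[OF that, of ?X] pq by (simp add: algebra_simps)
        qed
      qed (intro continuous_intros contR contX)+
      then have "real q *\<^sub>R trace (?X (0, 0) ** \<A> (0, 0)) - real p *\<^sub>R trace (?X (0, 0) ** \<B> (0, 0)) = 0"
        using pq by (simp add: R_def S_def scaleR_conv_of_real)
      moreover have "trace (?X (0, 0) ** Y (0, 0))
          = real q *\<^sub>R trace (?X (0, 0) ** \<A> (0, 0)) - real p *\<^sub>R trace (?X (0, 0) ** \<B> (0, 0))"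
        unfolding Y_right by (simp only: linear_diff[OF linear_trace] linear_cmul[OF linear_trace])
      ultimately show "trace (matrix_power (Y (0, 0)) (Suc k)) = 0"
        by (simp add: matrix_power_commute)
    qed
    moreover have "Y (0, 0) ** B 0 0 = B 0 0 ** Y (0, 0)"
      unfolding Y_left Y_right using comm by (simp add: AB0)
    moreover obtain v where "v \<noteq> 0" "B 0 0 *v v = \<mu> *s v"
      using \<mu> unfolding eigenvalue_of_def by blast
    ultimately obtain u where u: "u \<noteq> 0" "B 0 0 *v u = \<mu> *s u" "Y (0, 0) *v u = 0"
      using nilpotent_kernel_in_eigenspace by metis
    \<comment> \<open>Forced by \<open>Y u = 0\<close>, which says
      \<open>q A u = p B u = p \<mu> u\<close> at the origin.\<close>
    define lam where "lam = of_nat p * \<mu> / of_nat q"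
    have lam: "of_nat q * lam = of_nat p * \<mu>" using assms(2) by (simp add: lam_def)
    have "Y (0, 0) *v u = of_nat q *s (A 0 0 *v u) - of_nat p *s (B 0 0 *v u)"
      by (simp add: Y_def AB0 matrix_vector_mult_def vec_eq_iff sum_distrib_left sum_subtractf[symmetric]
          scaleR_conv_of_real[where 'a = complex] algebra_simps)
    then have "of_nat q *s (A 0 0 *v u) = of_nat q *s (lam *s u)"
      using u(2,3) by (simp add: lam vector_smult_assoc)
    then have "A 0 0 *v u = lam *s u"
      using assms(2) by (simp add: vec_eq_iff)
    then show ?thesis
      using u lam eigenvector_in_generalized_eigenspace[OF u(2)]
      unfolding eigenvalue_of_def eigenvalue_of_restriction_def by blast
  qed
  show ?thesis
    using nilA nilB eig invariant_subspace_generalized_eigenspace[OF comm] by blast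
qed

end
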